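(* Let $X$ be a Hausdorff topological space. Then $\mathcal{F}(X)$ has a $\tau_F$-continuous selection if and only if $\mathcal{F}_2(X)$ has a $\tau_F$-continuous selection.
   Context: For a topological space $X$, $\mathcal{F}(X)$ denotes the family of all non-empty closed subsets of $X$, and $\mathcal{F}_2(X)=\{S\in\mathcal{F}(X): |S|\le 2\}$. For a finite family $\mathcal{V}$ of open subsets of $X$, put $\langle\mathcal{V}\rangle=\{S\in\mathcal{F}(X): S\cap V\neq\emptyset \text{ for every } V\in\mathcal{V}, \text{ and } S\subset\bigcup\mathcal{V}\}$. The Fell topology $\tau_F$ on $\mathcal{F}(X)$ is the topology with base consisting of all sets $\langle\mathcal{V}\rangle$, where $\mathcal{V}$ is a finite family of open subsets of $X$ such that $X\setminus\bigcup\mathcal{V}$ is compact. For $\mathcal{D}\subset\mathcal{F}(X)$ and a topology $\tau$ on $\mathcal{F}(X)$, a selection for $\mathcal{D}$ is a map $f:\mathcal{D}\to X$ such that $f(S)\in S$ for every $S\in\mathcal{D}$; it is $\tau$-continuous if it is continuous with respect to the relative topology on $\mathcal{D}$ as a subspace of $(\mathcal{F}(X),\tau)$. *)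

theory Defs
  imports "HOL-Analysis.Analysis"
begin

definition hyperspace :: "'a topology \<Rightarrow> 'a set set" where
  "hyperspace X = {S. closedin X S \<and> S \<noteq> {}}"

definition hyperspace2 :: "'a topology \<Rightarrow> 'a set set" where
  "hyperspace2 X = {S \<in> hyperspace X. finite S \<and> card S \<le> 2}"

definition vietoris_set :: "'a topology \<Rightarrow> 'a set set \<Rightarrow> 'a set set" where
  "vietoris_set X \<V> = {S \<in> hyperspace X. (\<forall>V\<in>\<V>. S \<inter> V \<noteq> {}) \<and> S \<subseteq> \<Union>\<V>}"

definition fell_base :: "'a topology \<Rightarrow> 'a set set set" where
  "fell_base X = {vietoris_set X \<V> |\<V>.
     finite \<V> \<and> (\<forall>V\<in>\<V>. openin X V) \<and> compactin X (topspace X - \<Union>\<V>)}"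

definition fell_topology :: "'a topology \<Rightarrow> 'a set topology" where
  "fell_topology X = topology (arbitrary union_of (\<lambda>U. U \<in> fell_base X))"

definition selection_on :: "'a set set \<Rightarrow> ('a set \<Rightarrow> 'a) \<Rightarrow> bool" where
  "selection_on \<D> f \<longleftrightarrow> (\<forall>S\<in>\<D>. f S \<in> S)"

definition has_continuous_selection ::
    "'a topology \<Rightarrow> 'a set topology \<Rightarrow> 'a set set \<Rightarrow> bool" where
  "has_continuous_selection X \<tau> \<D> \<longleftrightarrow>
     (\<exists>f. selection_on \<D> f \<and> continuous_map (subtopology \<tau> \<D>) X f)"

text \<open>\<^const>\<open>topology\<close> is only meaningful on families satisfying \<^const>\<open>istopology\<close>;
  the following facts show that \<^const>\<open>fell_base\<close> really is a base of a topology with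
  carrier \<^const>\<open>hyperspace\<close>.\<close>

lemma fell_base_Int:
  assumes "P \<in> fell_base X" "Q \<in> fell_base X"
  shows "P \<inter> Q \<in> fell_base X"
proof -
  obtain A where A: "P = vietoris_set X A" "finite A" "\<forall>V\<in>A. openin X V"
      "compactin X (topspace X - \<Union>A)"
    using assms(1) by (auto simp: fell_base_def)
  obtain B where B: "Q = vietoris_set X B" "finite B" "\<forall>V\<in>B. openin X V"
      "compactin X (topspace X - \<Union>B)"
    using assms(2) by (auto simp: fell_base_def)
  define C where "C = (\<lambda>V. V \<inter> \<Union>B) ` A \<union> (\<lambda>W. W \<inter> \<Union>A) ` B"
  have UC: "\<Union>C = \<Union>A \<inter> \<Union>B"
    unfolding C_def by blast
  have "openin X (\<Union>A)" "openin X (\<Union>B)"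
    using A(3) B(3) by auto
  then have "\<forall>V\<in>C. openin X V"
    unfolding C_def using A(3) B(3) by auto
  moreover have "finite C"
    unfolding C_def using A(2) B(2) by simp
  moreover have "compactin X (topspace X - \<Union>C)"
    unfolding UC Diff_Int using A(4) B(4) by (rule compactin_Un)
  moreover have "P \<inter> Q = vietoris_set X C"
  proof (rule set_eqI)
    fix S
    have *: "S \<inter> (V \<inter> T) = S \<inter> V" if "S \<subseteq> T" for V T :: "'a set"
      using that by blast
    show "S \<in> P \<inter> Q \<longleftrightarrow> S \<in> vietoris_set X C"
    proof (cases "S \<subseteq> \<Union>A \<and> S \<subseteq> \<Union>B")
      case True
      then show ?thesis
        unfolding A(1) B(1) vietoris_set_def UC by (auto simp: C_def ball_Un *)
    next
      case False
      then show ?thesis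
        unfolding A(1) B(1) vietoris_set_def UC by blast
    qed
  qed
  ultimately show ?thesis
    unfolding fell_base_def by blast
qed

lemma openin_fell_topology:
  "openin (fell_topology X) = arbitrary union_of (\<lambda>U. U \<in> fell_base X)"
  unfolding fell_topology_def
  by (intro topology_inverse' istopology_base fell_base_Int)

lemma topspace_fell_topology: "topspace (fell_topology X) = hyperspace X"
proof
  show "topspace (fell_topology X) \<subseteq> hyperspace X"
    unfolding topspace_def openin_fell_topology
    by (auto simp: union_of_def fell_base_def vietoris_set_def)
  have "vietoris_set X {topspace X} = hyperspace X"
    using closedin_subset by (fastforce simp: vietoris_set_def hyperspace_def)
  then have "hyperspace X \<in> fell_base X"
    unfolding fell_base_def by (intro CollectI exI[of _ "{topspace X}"]) auto
  then have "openin (fell_topology X) (hyperspace X)"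
    unfolding openin_fell_topology by (rule arbitrary_union_of_inc)
  then show "hyperspace X \<subseteq> topspace (fell_topology X)"
    by (rule openin_subset)
qed

end

theory Submission
  imports Defs
begin

text \<open>A selection \<open>f\<close> for pairs gives a tournament \<open>x \<preceq> y \<longleftrightarrow> f {x, y} = x\<close>, in general not
  transitive. Fell continuity makes its graph closed and its initial segments compact, locally
  uniformly. Insert the points of the space, in some well-order, into a binary search tree with
  comparisons made by \<open>\<preceq>\<close>. The in-order traversal of the tree is a linear order. Along a branch,
  the pivots passed on the left have, by compactness, a limit, which is the \<open>\<preceq>\<close>-least point
  lying to the right of all of them. It follows that the initial segments of the traversal order
  are compact and its final segments closed. For such an order every nonempty closed set has a
  least element, and taking the least element is a Fell continuous selection.\<close>

section \<open>Search trees of tournaments\<close>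

text \<open>The condition on \<open>anc q x\<close> refers only to ancestors \<open>r\<close> of
  \<open>q\<close>, which precede \<open>q\<close> in \<open>W\<close>; so the set of descendants of
  \<open>q\<close> can be defined by well-founded recursion on \<open>q\<close>.\<close>

lemma ex_search_tree:
  assumes "wf W"
  shows "\<exists>anc. \<forall>q x. anc q x \<longleftrightarrow>
    (q, x) \<in> W \<and> (\<forall>r. anc r q \<longrightarrow> (R r q \<longleftrightarrow> R r x) \<and> (R q r \<longleftrightarrow> R x r))"
proof -
  define step where "step = (\<lambda>D q. {x. (q, x) \<in> W \<and>
    (\<forall>r. (r, q) \<in> W \<longrightarrow> q \<in> D r \<longrightarrow> (R r q \<longleftrightarrow> R r x) \<and> (R q r \<longleftrightarrow> R x r))})"
  define desc where "desc = wfrec W step"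
  have cut: "step (cut desc W q) q = step desc q" for q
    unfolding step_def by (auto simp: cut_apply)
  have desc: "desc q = step desc q" for q
    using wfrec[OF assms, of step q] by (simp add: cut flip: desc_def)
  then have mem: "x \<in> desc q \<longleftrightarrow> (q, x) \<in> W \<and>
    (\<forall>r. (r, q) \<in> W \<longrightarrow> q \<in> desc r \<longrightarrow> (R r q \<longleftrightarrow> R r x) \<and> (R q r \<longleftrightarrow> R x r))" for q x
    unfolding step_def by blast
  then have "x \<in> desc q \<longleftrightarrow> (q, x) \<in> W \<and>
    (\<forall>r. q \<in> desc r \<longrightarrow> (R r q \<longleftrightarrow> R r x) \<and> (R q r \<longleftrightarrow> R x r))" for q x
    by metis
  then show ?thesis
    by (intro exI[of _ "\<lambda>q x. x \<in> desc q"]) blast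
qed

text \<open>The points of \<open>T\<close> are inserted, in the order given by \<open>W\<close>, into a binary search tree
  whose comparisons are made with \<open>R\<close>; \<open>anc q x\<close> says that \<open>q\<close> is a proper ancestor of \<open>x\<close>.
  Every axiom is invariant under replacing \<open>R\<close> by its converse.\<close>

locale search_tree =
  fixes T :: "'a set" and R :: "'a \<Rightarrow> 'a \<Rightarrow> bool" and W :: "('a \<times> 'a) set"
    and anc :: "'a \<Rightarrow> 'a \<Rightarrow> bool"
  assumes R_carrier: "R x y \<Longrightarrow> x \<in> T \<and> y \<in> T"
    and R_total: "x \<in> T \<Longrightarrow> y \<in> T \<Longrightarrow> R x y \<or> R y x"
    and R_antisym: "R x y \<Longrightarrow> R y x \<Longrightarrow> x = y"
    and W_wf: "wf W"
    and W_trans: "trans W"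
    and W_carrier: "(x, y) \<in> W \<Longrightarrow> x \<in> T \<and> y \<in> T"
    and W_total: "x \<in> T \<Longrightarrow> y \<in> T \<Longrightarrow> x \<noteq> y \<Longrightarrow> (x, y) \<in> W \<or> (y, x) \<in> W"
    and anc_iff: "anc q x \<longleftrightarrow>
      (q, x) \<in> W \<and> (\<forall>r. anc r q \<longrightarrow> (R r q \<longleftrightarrow> R r x) \<and> (R q r \<longleftrightarrow> R x r))"
begin

text \<open>Through this symmetry, results on initial segments of the traversal also serve for its
  final segments.\<close>

lemma converse_search_tree: "search_tree T (\<lambda>x y. R y x) W anc"
proof
  show "anc q x \<longleftrightarrow> (q, x) \<in> W \<and>
    (\<forall>r. anc r q \<longrightarrow> (R q r \<longleftrightarrow> R x r) \<and> (R r q \<longleftrightarrow> R r x))" for q x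
    using anc_iff[of q x] by blast
qed (fact W_wf W_trans | erule W_carrier | erule (2) W_total |
  (drule R_carrier, simp) | (erule (1) R_antisym[rotated]) | (erule (1) R_total))+

section \<open>Ancestors as a tree order\<close>

lemma anc_W: "anc q x \<Longrightarrow> (q, x) \<in> W"
  using anc_iff by blast

lemma anc_carrier: "anc q x \<Longrightarrow> q \<in> T \<and> x \<in> T"
  using anc_W W_carrier by blast

lemma anc_same_side:
  "anc q x \<Longrightarrow> anc r q \<Longrightarrow> (R r q \<longleftrightarrow> R r x) \<and> (R q r \<longleftrightarrow> R x r)"
  using anc_iff by blast

lemma anc_irrefl: "\<not> anc q q"
  using anc_W[of q q] wf_not_refl[OF W_wf] by blast

text \<open>Induction on the topmost point: an ancestor \<open>s\<close> of \<open>r\<close> is by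
  induction one of \<open>q\<close>, so \<open>r\<close>, \<open>q\<close> and \<open>x\<close> all
  compare alike with \<open>s\<close>.\<close>

lemma anc_trans: "anc r q \<Longrightarrow> anc q x \<Longrightarrow> anc r x"
  using W_wf
proof (induction r arbitrary: q x rule: wf_induct_rule)
  case (less r)
  have "(r, x) \<in> W"
    using transD[OF W_trans anc_W anc_W] less.prems by blast
  moreover have "(R s r \<longleftrightarrow> R s x) \<and> (R r s \<longleftrightarrow> R x s)" if "anc s r" for s
  proof -
    have "anc s q"
      using less.IH[OF anc_W] that less.prems(1) by blast
    then show ?thesis
      using anc_same_side[OF less.prems(1) that] anc_same_side[OF less.prems(2)] by blast
  qed
  ultimately show ?case
    using anc_iff[of r x] by blast
qed

text \<open>By induction every ancestor \<open>s\<close> of \<open>r\<close> is one of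
  \<open>q\<close>, and \<open>r\<close> and \<open>q\<close> both compare with \<open>s\<close> as
  \<open>x\<close> does. Hence the ancestors of a point form a chain.\<close>

lemma anc_linear:
  assumes "anc r x" "anc q x" "(r, q) \<in> W"
  shows "anc r q"
  using W_wf assms(1,3)
proof (induction r rule: wf_induct_rule)
  case (less r)
  have "(R s r \<longleftrightarrow> R s q) \<and> (R r s \<longleftrightarrow> R q s)" if "anc s r" for s
  proof -
    have "anc s q"
      using less.IH[OF anc_W[OF that]] anc_trans[OF that less.prems(1)]
        transD[OF W_trans anc_W[OF that] less.prems(2)] by blast
    then show ?thesis
      using anc_same_side[OF less.prems(1) that] anc_same_side[OF assms(2)] by blast
  qed
  then show ?case
    using anc_iff less.prems(2) by blast
qed

section \<open>Separators and the traversal order\<close>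

definition anceq :: "'a \<Rightarrow> 'a \<Rightarrow> bool" where
  "anceq q x \<longleftrightarrow> q \<in> T \<and> (q = x \<or> anc q x)"

text \<open>If \<open>y\<close> is an ancestor of \<open>z\<close>, take \<open>y\<close> itself.
  Otherwise take the \<open>W\<close>-first ancestor of \<open>y\<close> with which \<open>y\<close>
  and \<open>z\<close> compare differently; minimality makes it an ancestor of \<open>z\<close> as
  well.\<close>

lemma ex_separator_aux:
  assumes "(y, z) \<in> W"
  shows "\<exists>q. anceq q y \<and> anceq q z \<and> (R y q \<and> R q z \<or> R z q \<and> R q y)"
proof (cases "anc y z")
  case True
  then show ?thesis
    unfolding anceq_def using R_total anc_carrier by metis
next
  case False
  define S where "S = {s. anc s y \<and> \<not> ((R s y \<longleftrightarrow> R s z) \<and> (R y s \<longleftrightarrow> R z s))}"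
  obtain s0 where "s0 \<in> S"
    using False assms anc_iff[of y z] by (auto simp: S_def)
  then obtain s where "s \<in> S" and min: "\<And>r. (r, s) \<in> W \<Longrightarrow> r \<notin> S"
    by (rule wfE_min[OF W_wf]) blast
  then have s: "anc s y" "\<not> ((R s y \<longleftrightarrow> R s z) \<and> (R y s \<longleftrightarrow> R z s))"
    by (auto simp: S_def)
  have "(s, z) \<in> W"
    using s assms anc_W[of s y] transD[OF W_trans, of s y z] by blast
  moreover have "(R r s \<longleftrightarrow> R r z) \<and> (R s r \<longleftrightarrow> R z r)" if "anc r s" for r
    using min[OF anc_W[OF that]] anc_trans[OF that s(1)] anc_same_side[OF s(1) that]
    by (simp add: S_def)
  ultimately have "anc s z"
    using anc_iff[of s z] by blast
  then show ?thesis
    unfolding anceq_def using s R_total[of s y] R_total[of s z] anc_carrier[of s] by blast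
qed

lemma ex_separator:
  assumes "y \<in> T" "z \<in> T" "y \<noteq> z"
  shows "\<exists>q. anceq q y \<and> anceq q z \<and> (R y q \<and> R q z \<or> R z q \<and> R q y)"
  using W_total[OF assms] ex_separator_aux by blast

text \<open>This is the in-order traversal of the tree: \<open>q\<close> is the lowest common ancestor.\<close>

definition lt :: "'a \<Rightarrow> 'a \<Rightarrow> bool" where
  "lt y z \<longleftrightarrow> y \<noteq> z \<and> (\<exists>q. anceq q y \<and> anceq q z \<and> R y q \<and> R q z)"

definition le :: "'a \<Rightarrow> 'a \<Rightarrow> bool" where
  "le y z \<longleftrightarrow> y \<in> T \<and> (y = z \<or> lt y z)"

lemma lt_carrier: "lt y z \<Longrightarrow> y \<in> T \<and> z \<in> T"
  unfolding lt_def using R_carrier by blast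

lemma le_carrier: "le y z \<Longrightarrow> y \<in> T \<and> z \<in> T"
  unfolding le_def using lt_carrier by blast

lemma le_refl: "x \<in> T \<Longrightarrow> le x x"
  unfolding le_def by blast

lemma le_total: "x \<in> T \<Longrightarrow> y \<in> T \<Longrightarrow> le x y \<or> le y x"
  unfolding le_def lt_def using ex_separator by metis

lemma anceq_cases:
  assumes "anceq q z" "anceq r z"
  shows "q = r \<or> anc q r \<or> anc r q"
  using assms W_total[of q r] anc_linear unfolding anceq_def by blast

lemma anceq_trans: "anc q r \<Longrightarrow> anceq r x \<Longrightarrow> anc q x"
  unfolding anceq_def using anc_trans by blast

lemma anceq_same_side:
  "anceq q x \<Longrightarrow> anc r q \<Longrightarrow> (R r q \<longleftrightarrow> R r x) \<and> (R q r \<longleftrightarrow> R x r)"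
  unfolding anceq_def using anc_same_side by blast

text \<open>Transitivity comes from the tree, not from \<open>R\<close>: the separators
  \<open>q\<close> and \<open>r\<close> both lie on the branch of \<open>z\<close>, and the higher
  one separates \<open>y\<close> from \<open>u\<close>, because the lower one and its descendants
  lie on one side of it.\<close>

lemma lt_trans:
  assumes "lt y z" "lt z u"
  shows "lt y u"
proof -
  obtain q where q: "anceq q y" "anceq q z" "R y q" "R q z" and "y \<noteq> z"
    using assms(1) unfolding lt_def by blast
  obtain r where r: "anceq r z" "anceq r u" "R z r" "R r u" and "z \<noteq> u"
    using assms(2) unfolding lt_def by blast
  consider "q = r" | "anc q r" | "anc r q"
    using anceq_cases q(2) r(1) by blast
  then show ?thesis
  proof cases
    case 1
    then have "y \<noteq> u"
      using q r \<open>y \<noteq> z\<close> R_antisym by blast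
    then show ?thesis
      using 1 q r unfolding lt_def by blast
  next
    case 2
    then have "anc q u"
      using r anceq_trans by blast
    moreover have "R q u"
      using 2 q(4) r anceq_same_side by blast
    ultimately show ?thesis
      unfolding lt_def using q R_antisym anc_irrefl anceq_def by metis
  next
    case 3
    then have "anc r y"
      using q anceq_trans by blast
    moreover have "R y r"
      using 3 r(3) q anceq_same_side by blast
    ultimately show ?thesis
      unfolding lt_def using r R_antisym anc_irrefl anceq_def by metis
  qed
qed

lemma le_trans: "le x y \<Longrightarrow> le y z \<Longrightarrow> le x z"
  unfolding le_def using lt_trans by blast

lemma le_antisym: "le x y \<Longrightarrow> le y x \<Longrightarrow> x = y"
  unfolding le_def using lt_trans[of x y x] by (auto simp: lt_def)

text \<open>The points that no ancestor of \<open>q\<close> strictly separates from \<open>q\<close>. Points inserted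
  before \<open>q\<close> may belong to it, which makes it closed.\<close>

definition cell :: "'a \<Rightarrow> 'a set" where
  "cell q = {y \<in> T. \<forall>r. anc r q \<longrightarrow> (R r q \<longrightarrow> R r y) \<and> (R q r \<longrightarrow> R y r)}"

definition left_cell :: "'a \<Rightarrow> 'a set" where
  "left_cell q = {y \<in> cell q. R y q}"

definition right_cell :: "'a \<Rightarrow> 'a set" where
  "right_cell q = {y \<in> cell q. R q y}"

text \<open>These are the pivots at which the descent to \<open>x\<close> turns right.\<close>

definition left_anc :: "'a \<Rightarrow> 'a set" where
  "left_anc x = {q. anc q x \<and> R q x}"

lemma anceq_cell: "anceq q y \<Longrightarrow> y \<in> cell q"
  using anceq_same_side[of q y] anceq_def[of q y] anc_carrier[of q y] by (auto simp: cell_def)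

lemma cell_anc_mono:
  assumes "anc q r"
  shows "cell r \<subseteq> cell q"
  using anc_trans[OF _ assms] anc_same_side[OF assms] by (auto simp: cell_def)

text \<open>A separator \<open>q\<close> with \<open>x\<close> on its left and \<open>y\<close> on
  its right would be \<open>x\<close> or an ancestor of \<open>x\<close>. In the second case the
  cell condition gives \<open>R y q\<close>, hence \<open>y = q\<close>; either way antisymmetry
  forces \<open>y = x\<close>.\<close>

lemma left_cell_le:
  assumes "y \<in> left_cell x"
  shows "le y x"
proof (cases "y = x")
  case True
  then show ?thesis
    using assms R_carrier by (auto simp: left_cell_def le_def)
next
  case False
  have y: "y \<in> cell x" "R y x" "y \<in> T" "x \<in> T"
    using assms R_carrier by (auto simp: left_cell_def)
  obtain q where q: "anceq q y" "anceq q x" "R y q \<and> R q x \<or> R x q \<and> R q y"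
    using ex_separator[OF y(3,4) False] by blast
  have "\<not> (R x q \<and> R q y)"
  proof
    assume *: "R x q \<and> R q y"
    show False
    proof (cases "q = x")
      case True
      then show ?thesis
        using * False y(2) R_antisym by blast
    next
      case neq: False
      then have "anc q x"
        using q(2) anceq_def by blast
      then have "R y q"
        using y(1) * unfolding cell_def by blast
      then have "y = q"
        using * R_antisym by blast
      then show ?thesis
        using * False y(2) R_antisym by blast
    qed
  qed
  then show ?thesis
    using q False y(3) unfolding le_def lt_def by blast
qed

lemma left_anc_le:
  assumes "q \<in> left_anc x"
  shows "le q x"
proof -
  have "anc q x" "R q x"
    using assms by (auto simp: left_anc_def)
  moreover have "R q q"
    using R_total[of q q] R_carrier \<open>R q x\<close> by blast
  ultimately show ?thesis
    unfolding le_def lt_def anceq_def using anc_carrier by blast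
qed

text \<open>A separator with \<open>y\<close> on its left and \<open>x\<close> on its right is
  \<open>x\<close> itself or a left ancestor of \<open>x\<close>. Initial segments thus become
  unions of left cells.\<close>

lemma le_iff_left_cell:
  assumes "x \<in> T"
  shows "le y x \<longleftrightarrow> y \<in> left_cell x \<or> (\<exists>q\<in>left_anc x. y \<in> left_cell q)"
proof
  assume "le y x"
  show "y \<in> left_cell x \<or> (\<exists>q\<in>left_anc x. y \<in> left_cell q)"
  proof (cases "y = x")
    case True
    then show ?thesis
      using assms anceq_cell[of x x] R_total[of x x] unfolding left_cell_def anceq_def by blast
  next
    case False
    then obtain q where "anceq q y" "anceq q x" "R y q" "R q x"
      using \<open>le y x\<close> unfolding le_def lt_def by blast
    then show ?thesis
      using anceq_cell unfolding left_cell_def left_anc_def anceq_def by blast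
  qed
next
  assume "y \<in> left_cell x \<or> (\<exists>q\<in>left_anc x. y \<in> left_cell q)"
  then show "le y x"
    using left_cell_le left_anc_le le_trans by blast
qed

lemma left_anc_mono:
  assumes "q \<in> left_anc x" "r \<in> left_anc x" "(q, r) \<in> W"
  shows "q \<in> left_anc r"
  using assms anc_linear[of q x r] anc_same_side[of r x q] unfolding left_anc_def by blast

lemma cell_subset_right_cell: "q \<in> left_anc r \<Longrightarrow> cell r \<subseteq> right_cell q"
  using cell_anc_mono unfolding left_anc_def right_cell_def by (force simp: cell_def)

text \<open>Left ancestors constrain \<open>a\<close> through their right cells. A right ancestor
  \<open>r\<close> of \<open>x\<close> either lies in the intersection, so \<open>R a r\<close>, or
  misses the right cell of some left ancestor \<open>q\<close>; then \<open>r\<close> is above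
  \<open>q\<close>, and its constraint is already part of \<open>cell q\<close>.\<close>

lemma lower_bound_in_cell:
  assumes a: "a \<in> (\<Inter>q\<in>left_anc x. right_cell q)"
    and lower: "\<And>d. d \<in> (\<Inter>q\<in>left_anc x. right_cell q) \<Longrightarrow> R a d"
  shows "a \<in> left_cell x"
proof -
  let ?D = "\<Inter>q\<in>left_anc x. right_cell q"
  have "x \<in> ?D"
    using anceq_cell anc_carrier unfolding left_anc_def right_cell_def anceq_def by blast
  then have "R a x"
    using lower by blast
  moreover have "R a r" if r: "anc r x" "R x r" for r
  proof (cases "r \<in> ?D")
    case True
    then show ?thesis
      using lower by blast
  next
    case False
    then obtain q where q: "q \<in> left_anc x" "r \<notin> right_cell q"
      by blast
    then have qx: "anc q x" "R q x"
      by (auto simp: left_anc_def)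
    have "r \<in> T" "q \<in> T"
      using r qx anc_carrier by blast+
    moreover have "q \<noteq> r"
      using r(2) qx(2) R_antisym qx(1) anc_irrefl by blast
    \<comment> \<open>Were \<open>q\<close> the earlier one, \<open>r\<close> would be a descendant
      of \<open>q\<close> on its right.\<close>
    moreover have "(q, r) \<notin> W"
    proof
      assume "(q, r) \<in> W"
      then have "anc q r"
        using anc_linear qx r by blast
      then have "r \<in> cell q" "R q r"
        using anceq_cell anceq_def \<open>q \<in> T\<close> anc_same_side[OF r(1)] qx by blast+
      then show False
        using q(2) by (simp add: right_cell_def)
    qed
    ultimately have "anc r q"
      using W_total anc_linear[OF r(1) qx(1)] by blast
    moreover from this have "R q r"
      using anc_same_side[OF qx(1)] r(2) by blast
    moreover have "a \<in> cell q"
      using a q(1) by (auto simp: right_cell_def)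
    ultimately show ?thesis
      unfolding cell_def by blast
  qed
  moreover have "R r a" if "anc r x" "R r x" for r
    using a that by (auto simp: left_anc_def right_cell_def)
  ultimately show ?thesis
    using R_carrier unfolding left_cell_def cell_def by blast
qed

end

section \<open>Topology of the traversal order\<close>

text \<open>Directedness gives every finite subfamily a lower bound in \<open>\<H>\<close>, so
  meeting \<open>K\<close> one set at a time already yields the finite intersection
  property.\<close>

lemma compactin_directed_Inter:
  assumes K: "compactin X K"
    and closed: "\<And>H. H \<in> \<H> \<Longrightarrow> closedin X H"
    and ne: "\<And>H. H \<in> \<H> \<Longrightarrow> K \<inter> H \<noteq> {}" and "\<H> \<noteq> {}"
    and directed: "\<And>G H. G \<in> \<H> \<Longrightarrow> H \<in> \<H> \<Longrightarrow> \<exists>F\<in>\<H>. F \<subseteq> G \<inter> H"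
  shows "K \<inter> \<Inter>\<H> \<noteq> {}"
proof -
  have lower: "\<exists>F\<in>\<H>. F \<subseteq> \<Inter>\<G>" if "finite \<G>" "\<G> \<subseteq> \<H>" for \<G>
    using that
  proof (induction \<G>)
    case empty
    then show ?case
      using \<open>\<H> \<noteq> {}\<close> by auto
  next
    case (insert G \<G>)
    then obtain F where F: "F \<in> \<H>" "F \<subseteq> \<Inter>\<G>"
      by blast
    obtain E where "E \<in> \<H>" "E \<subseteq> G \<inter> F"
      using directed[of G F] insert.prems F(1) by blast
    then show ?case
      using F(2) by (intro bexI[of _ E]) auto
  qed
  have "K \<inter> \<Inter>\<G> \<noteq> {}" if "finite \<G>" "\<G> \<subseteq> \<H>" for \<G>
    using lower[OF that] ne by blast
  then show ?thesis
    using K closed by (simp add: compactin_fip)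
qed

text \<open>The axiom \<open>closed_graph\<close> is closedness of \<open>R\<close> in the product
  of \<open>X\<close> with itself, expressed by open boxes.\<close>

locale topological_search_tree = search_tree "topspace X" R W anc
  for X :: "'a topology" and R W anc +
  assumes closed_graph: "\<lbrakk>x \<in> topspace X; y \<in> topspace X; \<not> R x y\<rbrakk> \<Longrightarrow>
    \<exists>P Q. openin X P \<and> openin X Q \<and> x \<in> P \<and> y \<in> Q \<and> (\<forall>u\<in>P. \<forall>v\<in>Q. \<not> R u v)"
begin

lemma converse_topological_search_tree: "topological_search_tree X (\<lambda>x y. R y x) W anc"
proof -
  interpret conv: search_tree "topspace X" "\<lambda>x y. R y x" W anc
    by (rule converse_search_tree)
  show ?thesis
  proof
    fix x y
    assume "x \<in> topspace X" "y \<in> topspace X" "\<not> R y x"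
    then obtain P Q where "openin X P" "openin X Q" "y \<in> P" "x \<in> Q" "\<forall>u\<in>P. \<forall>v\<in>Q. \<not> R u v"
      using closed_graph[of y x] by blast
    then show "\<exists>P Q. openin X P \<and> openin X Q \<and> x \<in> P \<and> y \<in> Q \<and> (\<forall>u\<in>P. \<forall>v\<in>Q. \<not> R v u)"
      by blast
  qed
qed

lemma closedin_R_above:
  assumes "q \<in> topspace X"
  shows "closedin X {y. R q y}"
proof -
  have "\<exists>Q. openin X Q \<and> y \<in> Q \<and> Q \<subseteq> topspace X - {y. R q y}"
    if "y \<in> topspace X - {y. R q y}" for y
  proof -
    have y: "y \<in> topspace X" "\<not> R q y"
      using that by auto
    obtain P Q where "openin X P" "openin X Q" "q \<in> P" "y \<in> Q" "\<forall>u\<in>P. \<forall>v\<in>Q. \<not> R u v"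
      using closed_graph[OF assms y] by blast
    then show ?thesis
      using openin_subset[of X Q] by (intro exI[of _ Q]) auto
  qed
  then have "openin X (topspace X - {y. R q y})"
    by (subst openin_subopen) blast
  then show ?thesis
    using R_carrier by (auto simp: closedin_def)
qed

lemma closedin_R_below:
  assumes "q \<in> topspace X"
  shows "closedin X {y. R y q}"
  using topological_search_tree.closedin_R_above[OF converse_topological_search_tree assms] .

lemma closedin_cell: "q \<in> topspace X \<Longrightarrow> closedin X (cell q)"
proof -
  assume q: "q \<in> topspace X"
  \<comment> \<open>Inserting \<open>topspace X\<close> keeps the family nonempty when
    \<open>q\<close> has no ancestors.\<close>
  let ?\<F> = "insert (topspace X) ((\<lambda>r. {y. R r y}) ` {r. anc r q \<and> R r q} \<union>
    (\<lambda>r. {y. R y r}) ` {r. anc r q \<and> R q r})"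
  have "closedin X (\<Inter>?\<F>)"
    by (rule closedin_Inter) (use closedin_R_above closedin_R_below anc_carrier in auto)
  moreover have "\<Inter>?\<F> = cell q"
    unfolding cell_def by auto
  ultimately show ?thesis
    by simp
qed

lemma closedin_left_cell: "q \<in> topspace X \<Longrightarrow> closedin X (left_cell q)"
  using closedin_Int[OF closedin_cell closedin_R_below]
  by (simp add: left_cell_def Collect_conj_eq)

lemma closedin_right_cell: "q \<in> topspace X \<Longrightarrow> closedin X (right_cell q)"
  using closedin_Int[OF closedin_cell closedin_R_above]
  by (simp add: right_cell_def Collect_conj_eq)

text \<open>A point \<open>z\<close> approached by \<open>left_cell r\<close> along the left ancestors \<open>r\<close> of \<open>x\<close> satisfies
  \<open>R z a\<close> for any cluster point \<open>a\<close> of these ancestors, while \<open>a\<close> is the \<open>R\<close>-least point to the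
  right of all of them; so \<open>z = a\<close>.\<close>

lemma in_left_cell_of_closure:
  assumes q0: "q0 \<in> left_anc x" and K: "compactin X K"
    and tail: "\<And>r. r \<in> left_anc x \<Longrightarrow> (q0, r) \<in> W \<Longrightarrow> r \<in> K"
    and z: "z \<in> topspace X"
    and near: "\<And>q P. q \<in> left_anc x \<Longrightarrow> openin X P \<Longrightarrow> z \<in> P \<Longrightarrow>
      \<exists>r\<in>left_anc x. (q, r) \<in> W \<and> left_cell r \<inter> P \<noteq> {}"
  shows "z \<in> left_cell x"
proof -
  let ?J = "left_anc x"
  let ?D = "\<Inter>q\<in>?J. right_cell q"
  \<comment> \<open>The cluster point has to be taken along pivots whose left cells come near
    \<open>z\<close>; a common point of all closures in \<open>\<H>\<close> does this for every
    neighbourhood of \<open>z\<close> at once.\<close>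
  define N where "N q P = {r \<in> ?J. (q, r) \<in> W \<and> left_cell r \<inter> P \<noteq> {}}" for q P
  define \<H> where "\<H> = {X closure_of N q P | q P. q \<in> ?J \<and> (q0 = q \<or> (q0, q) \<in> W) \<and> openin X P \<and> z \<in> P}"
  have J: "q \<in> topspace X" if "q \<in> ?J" for q
    using that anc_carrier by (auto simp: left_anc_def)
  have J_right: "left_cell r \<subseteq> right_cell q" "r \<in> right_cell q"
    if "q \<in> ?J" "r \<in> ?J" "(q, r) \<in> W" for q r
    using cell_subset_right_cell[OF left_anc_mono[OF that]] anceq_cell[of r r] J[OF that(2)]
    by (auto simp: left_cell_def anceq_def)
  have N_top: "N q P \<subseteq> topspace X" for q P
    using J by (auto simp: N_def)
  have "K \<inter> \<Inter>\<H> \<noteq> {}"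
  proof (rule compactin_directed_Inter[OF K])
    show "closedin X H" if "H \<in> \<H>" for H
      using that by (auto simp: \<H>_def)
    show "K \<inter> H \<noteq> {}" if "H \<in> \<H>" for H
    proof -
      obtain q P where H: "H = X closure_of N q P" "q \<in> ?J" "q0 = q \<or> (q0, q) \<in> W"
          "openin X P" "z \<in> P"
        using \<open>H \<in> \<H>\<close> unfolding \<H>_def by blast
      obtain r where r: "r \<in> ?J" "(q, r) \<in> W" "left_cell r \<inter> P \<noteq> {}"
        using near[OF H(2,4,5)] by blast
      then have "r \<in> H"
        using closure_of_subset[OF N_top, of q P] by (auto simp: H(1) N_def)
      moreover have "(q0, r) \<in> W"
        using H(3) r(2) transD[OF W_trans, of q0 q r] by blast
      ultimately show ?thesis
        using tail r(1) by blast
    qed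
    have "X closure_of N q0 (topspace X) \<in> \<H>"
      unfolding \<H>_def using q0 z by blast
    then show "\<H> \<noteq> {}"
      by blast
    show "\<exists>F\<in>\<H>. F \<subseteq> G \<inter> H" if "G \<in> \<H>" "H \<in> \<H>" for G H
    proof -
      obtain q P where G: "G = X closure_of N q P" "q \<in> ?J" "q0 = q \<or> (q0, q) \<in> W"
          "openin X P" "z \<in> P"
        using \<open>G \<in> \<H>\<close> unfolding \<H>_def by blast
      obtain q' P' where H: "H = X closure_of N q' P'" "q' \<in> ?J" "q0 = q' \<or> (q0, q') \<in> W"
          "openin X P'" "z \<in> P'"
        using \<open>H \<in> \<H>\<close> unfolding \<H>_def by blast
      \<comment> \<open>The later of the two pivots, with the intersection of the two
        neighbourhoods, gives a member of \<open>\<H>\<close> below both.\<close>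
      obtain p where p: "p \<in> {q, q'}" "q = p \<or> (q, p) \<in> W" "q' = p \<or> (q', p) \<in> W"
        using W_total[of q q'] J[OF G(2)] J[OF H(2)] by blast
      have "N p (P \<inter> P') \<subseteq> N q P" "N p (P \<inter> P') \<subseteq> N q' P'"
        using p(2,3) transD[OF W_trans] unfolding N_def by blast+
      then have "X closure_of N p (P \<inter> P') \<subseteq> G \<inter> H"
        unfolding G(1) H(1) by (simp add: closure_of_mono)
      moreover have "X closure_of N p (P \<inter> P') \<in> \<H>"
        unfolding \<H>_def using p(1) G(2-5) H(2-5) openin_Int[OF G(4) H(4)] by blast
      ultimately show ?thesis
        by blast
    qed
  qed
  then obtain a where a: "a \<in> \<Inter>\<H>" "a \<in> topspace X"
    using compactin_subset_topspace[OF K] by blast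
  have cluster: "\<exists>r\<in>?J. (q, r) \<in> W \<and> r \<in> A \<and> left_cell r \<inter> P \<noteq> {}"
    if hyp: "q \<in> ?J" "openin X A" "a \<in> A" "openin X P" "z \<in> P" for q A P
  proof -
    obtain p where p: "p \<in> ?J" "q0 = p \<or> (q0, p) \<in> W" "q = p \<or> (q, p) \<in> W"
      using W_total[of q q0] J[OF hyp(1)] J[OF q0] hyp(1) q0 by blast
    have "X closure_of N p P \<in> \<H>"
      unfolding \<H>_def using p(1,2) hyp(4,5) by blast
    then have "a \<in> X closure_of N p P"
      using a(1) by blast
    then obtain r where "r \<in> N p P" "r \<in> A"
      using hyp(2,3) unfolding in_closure_of by blast
    then show ?thesis
      using p(3) transD[OF W_trans, of q p r] by (auto simp: N_def)
  qed
  \<comment> \<open>For \<open>r\<close> beyond \<open>q\<close>, the closed set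
    \<open>right_cell q\<close> contains both \<open>r\<close> and \<open>left_cell r\<close>; so it
    contains the limits \<open>a\<close> and, below, \<open>z\<close>.\<close>
  have "a \<in> right_cell q" if "q \<in> ?J" for q
  proof (rule ccontr)
    assume "a \<notin> right_cell q"
    then show False
      using cluster[OF that, of "topspace X - right_cell q" "topspace X"] a(2) z J_right(2)[OF that]
        closedin_right_cell[OF J[OF that]]
      by blast
  qed
  then have aD: "a \<in> ?D"
    by blast
  have "z \<in> right_cell q" if "q \<in> ?J" for q
  proof (rule ccontr)
    assume "z \<notin> right_cell q"
    then show False
      using cluster[OF that, of "topspace X" "topspace X - right_cell q"] a(2) z J_right(1)[OF that]
        closedin_right_cell[OF J[OF that]]
      by blast
  qed
  then have zD: "z \<in> ?D"
    by blast
  \<comment> \<open>All pivots lie in the closed set \<open>{y. R y d}\<close>, hence so does their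
    cluster point.\<close>
  have lower: "R a d" if "d \<in> ?D" for d
  proof (rule ccontr)
    assume "\<not> R a d"
    moreover have d: "R r d" if "r \<in> ?J" for r
      using that \<open>d \<in> ?D\<close> by (auto simp: right_cell_def)
    moreover have "d \<in> topspace X"
      using d[OF q0] R_carrier by blast
    ultimately show False
      using cluster[OF q0, of "topspace X - {y. R y d}" "topspace X"] a(2) z
        closedin_R_below[of d]
      by blast
  qed
  have "R z a"
  proof (rule ccontr)
    assume "\<not> R z a"
    then obtain P Q where "openin X P" "openin X Q" "z \<in> P" "a \<in> Q"
        and PQ: "\<And>u v. u \<in> P \<Longrightarrow> v \<in> Q \<Longrightarrow> \<not> R u v"
      using closed_graph[OF z a(2)] by blast
    then obtain r where "r \<in> Q" "left_cell r \<inter> P \<noteq> {}"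
      using cluster[OF q0] by blast
    then show False
      using PQ by (auto simp: left_cell_def)
  qed
  then have "z = a"
    using lower[OF zD] R_antisym by blast
  then show ?thesis
    using lower_bound_in_cell[OF aD lower] by blast
qed

text \<open>Induction along \<open>W\<close>. If the left ancestors have a last member
  \<open>q\<close>, the segment is that of \<open>q\<close> plus one left cell. If there are none,
  it is a left cell. Otherwise a closure point outside the segment is approached by left cells
  arbitrarily far along the branch, and compactness from \<open>tail\<close> puts it into
  \<open>left_cell x\<close>.\<close>

lemma closedin_le_below:
  assumes x: "x \<in> topspace X"
    and tail: "\<And>p q. q \<in> left_anc p \<Longrightarrow>
      \<exists>K. compactin X K \<and> (\<forall>r\<in>left_anc p. (q, r) \<in> W \<longrightarrow> r \<in> K)"
  shows "closedin X {y. le y x}"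
  using W_wf x
proof (induction x rule: wf_induct_rule)
  case (less x)
  let ?J = "left_anc x"
  have J: "q \<in> topspace X" "(q, x) \<in> W" if "q \<in> ?J" for q
    using that anc_carrier anc_W by (auto simp: left_anc_def)
  have IH: "closedin X {y. le y q}" if "q \<in> ?J" for q
    using less.IH J[OF that] by blast
  have split: "{y. le y x} = left_cell x \<union> (\<Union>q\<in>?J. left_cell q)"
    using le_iff_left_cell[OF less.prems] by auto
  \<comment> \<open>A pivot \<open>r\<close> not beyond \<open>q\<close> is \<open>q\<close> or a
    left ancestor of \<open>q\<close>.\<close>
  have le_J: "le y q" if "q \<in> ?J" "r \<in> ?J" "(q, r) \<notin> W" "y \<in> left_cell r" for y q r
    using left_anc_mono[of r x q] left_anc_le[of r q] left_cell_le[OF that(4)] le_trans that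
      W_total[of q r] J(1) by blast
  show ?case
  proof (cases "\<exists>q\<in>?J. \<forall>r\<in>?J. (q, r) \<notin> W")
    case True
    then obtain q where q: "q \<in> ?J" "\<And>r. r \<in> ?J \<Longrightarrow> (q, r) \<notin> W"
      by blast
    have "{y. le y x} = left_cell x \<union> {y. le y q}"
      using le_J[OF q(1)] q le_iff_left_cell[OF less.prems] left_anc_le[OF q(1)] le_trans by blast
    then show ?thesis
      using closedin_left_cell[OF less.prems] IH[OF q(1)] by (simp add: closedin_Un)
  next
    case False
    show ?thesis
    proof (cases "?J = {}")
      case True
      then show ?thesis
        using split closedin_left_cell[OF less.prems] by simp
    next
      case ne: False
      then obtain q0 where q0: "q0 \<in> ?J"
        by blast
      obtain K where K: "compactin X K" "\<And>r. r \<in> ?J \<Longrightarrow> (q0, r) \<in> W \<Longrightarrow> r \<in> K"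
        using tail[OF q0] by blast
      have "z \<in> {y. le y x}" if cl: "z \<in> X closure_of {y. le y x}" for z
      proof (rule ccontr)
        assume nz: "z \<notin> {y. le y x}"
        have z: "z \<in> topspace X"
          using that by (simp add: in_closure_of)
        have "z \<in> left_cell x"
        proof (rule in_left_cell_of_closure[OF q0 K z])
          fix q P
          assume *: "q \<in> ?J" "openin X P" "z \<in> P"
          \<comment> \<open>In this smaller neighbourhood of \<open>z\<close>, every point of the
            segment comes from the left cell of a pivot beyond \<open>q\<close>.\<close>
          let ?P = "P - (left_cell x \<union> {y. le y q})"
          have "openin X ?P"
            using closedin_left_cell[OF less.prems] IH[OF *(1)] *(2) by blast
          moreover have "z \<in> ?P"
            using nz split *(1,3) left_anc_le[OF *(1)] le_trans by blast
          ultimately obtain y where y: "y \<in> {y. le y x}" "y \<in> ?P"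
            using cl by (meson in_closure_of)
          then obtain r where "r \<in> ?J" "y \<in> left_cell r"
            unfolding split by blast
          then show "\<exists>r\<in>?J. (q, r) \<in> W \<and> left_cell r \<inter> P \<noteq> {}"
            using le_J[OF *(1)] y(2) by blast
        qed
        then show False
          using nz split by blast
      qed
      moreover have "{y. le y x} \<subseteq> topspace X"
        using le_carrier by blast
      ultimately show ?thesis
        using closure_of_subset_eq[of "{y. le y x}" X] by blast
    qed
  qed
qed

text \<open>Each point of the segment is \<open>R\<close>-below some \<open>q\<close> that is
  \<open>R\<close>-below \<open>x\<close>, with \<open>q = x\<close> allowed; so \<open>K\<close>
  contains the segment.\<close>

lemma compactin_le_below:
  assumes x: "x \<in> topspace X"
    and K: "compactin X K" "\<And>q y. R q x \<Longrightarrow> R y q \<Longrightarrow> y \<in> K"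
    and closed: "closedin X {y. le y x}"
  shows "compactin X {y. le y x}"
proof -
  have "R x x"
    using R_total x by blast
  then have "{y. le y x} \<subseteq> K"
    using K(2) le_iff_left_cell[OF x] by (auto simp: left_cell_def left_anc_def)
  then show ?thesis
    using closed_compactin[OF K(1) _ closed] by blast
qed

end

section \<open>Fell continuity of the minimum\<close>

lemma continuous_map_fell_neighbourhood:
  assumes f: "continuous_map (subtopology (fell_topology X) \<D>) X f" and "\<D> \<subseteq> hyperspace X"
    and "S \<in> \<D>" "openin X U" "f S \<in> U"
  obtains \<V> where "finite \<V>" "\<And>V. V \<in> \<V> \<Longrightarrow> openin X V" "compactin X (topspace X - \<Union>\<V>)"
    "\<And>V. V \<in> \<V> \<Longrightarrow> S \<inter> V \<noteq> {}" "S \<subseteq> \<Union>\<V>"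
    "\<And>S'. \<lbrakk>S' \<in> \<D>; \<And>V. V \<in> \<V> \<Longrightarrow> S' \<inter> V \<noteq> {}; S' \<subseteq> \<Union>\<V>\<rbrakk> \<Longrightarrow> f S' \<in> U"
proof -
  have top: "topspace (subtopology (fell_topology X) \<D>) = \<D>"
    using assms(2) by (auto simp: topspace_fell_topology)
  have "openin (subtopology (fell_topology X) \<D>) {S \<in> \<D>. f S \<in> U}"
    using openin_continuous_map_preimage[OF f assms(4)] unfolding top .
  then obtain O' where O': "openin (fell_topology X) O'" "{S \<in> \<D>. f S \<in> U} = O' \<inter> \<D>"
    by (auto simp: openin_subtopology)
  then have "S \<in> O'"
    using assms(3,5) by blast
  then obtain B where B: "B \<in> fell_base X" "S \<in> B" "B \<subseteq> O'"
    using O'(1) unfolding openin_fell_topology arbitrary_union_of_alt by blast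
  then obtain \<V> where V: "B = vietoris_set X \<V>" "finite \<V>" "\<forall>V\<in>\<V>. openin X V"
      "compactin X (topspace X - \<Union>\<V>)"
    by (auto simp: fell_base_def)
  show thesis
  proof (rule that[of \<V>])
    show "f S' \<in> U" if "S' \<in> \<D>" "\<And>V. V \<in> \<V> \<Longrightarrow> S' \<inter> V \<noteq> {}" "S' \<subseteq> \<Union>\<V>" for S'
    proof -
      have "S' \<in> B"
        using that assms(2) by (auto simp: V(1) vietoris_set_def)
      then show ?thesis
        using B(3) O'(2) that(1) by blast
    qed
  qed (use V B(2) in \<open>auto simp: vietoris_set_def\<close>)
qed

lemma continuous_map_fellI:
  assumes "\<And>S. S \<in> hyperspace X \<Longrightarrow> f S \<in> topspace X"
    and nbhd: "\<And>S U. \<lbrakk>S \<in> hyperspace X; openin X U; f S \<in> U\<rbrakk> \<Longrightarrow>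
      \<exists>V K. openin X V \<and> compactin X K \<and> closedin X K \<and> S \<inter> V \<noteq> {} \<and> S \<inter> K = {} \<and>
        (\<forall>S'\<in>hyperspace X. S' \<inter> V \<noteq> {} \<longrightarrow> S' \<inter> K = {} \<longrightarrow> f S' \<in> U)"
  shows "continuous_map (fell_topology X) X f"
  unfolding continuous_map
proof (intro conjI allI impI)
  show "f ` topspace (fell_topology X) \<subseteq> topspace X"
    using assms(1) by (auto simp: topspace_fell_topology)
  fix U
  assume U: "openin X U"
  have "\<exists>B\<in>fell_base X. S \<in> B \<and> B \<subseteq> {S \<in> hyperspace X. f S \<in> U}"
    if S: "S \<in> hyperspace X" "f S \<in> U" for S
  proof -
    obtain V K where VK: "openin X V" "compactin X K" "closedin X K" "S \<inter> V \<noteq> {}" "S \<inter> K = {}"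
      and sub: "\<forall>S'\<in>hyperspace X. S' \<inter> V \<noteq> {} \<longrightarrow> S' \<inter> K = {} \<longrightarrow> f S' \<in> U"
      using nbhd[OF S(1) U S(2)] by (elim exE conjE)
    \<comment> \<open>With \<open>K\<close> cut out of \<open>V\<close>, the union is exactly the
      complement of \<open>K\<close>. \<open>S\<close> meets both members since it meets
      \<open>V\<close> and misses \<open>K\<close>.\<close>
    let ?\<V> = "{V - K, topspace X - K}"
    have Un: "\<Union>?\<V> = topspace X - K"
      using openin_subset[OF VK(1)] by auto
    have "topspace X - (topspace X - K) = K"
      using closedin_subset[OF VK(3)] by blast
    then have "vietoris_set X ?\<V> \<in> fell_base X"
      unfolding fell_base_def using VK(1-3) Un
      by (intro CollectI exI[of _ ?\<V>]) auto
    moreover have "S \<in> vietoris_set X ?\<V>"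
      unfolding vietoris_set_def Un using S(1) VK(4,5) closedin_subset
      by (fastforce simp: hyperspace_def)
    moreover have "vietoris_set X ?\<V> \<subseteq> {S \<in> hyperspace X. f S \<in> U}"
      using sub unfolding vietoris_set_def Un by auto
    ultimately show ?thesis
      by blast
  qed
  then show "openin (fell_topology X) {S \<in> topspace (fell_topology X). f S \<in> U}"
    unfolding openin_fell_topology arbitrary_union_of_alt topspace_fell_topology by blast
qed

text \<open>Minima exist because compact initial segments form a chain. For continuity at
  \<open>S\<close> with minimum \<open>m\<close> in \<open>U\<close>, it suffices that
  \<open>S'\<close> hits a small neighbourhood of \<open>m\<close> and misses the compact set of
  points below \<open>m\<close> outside \<open>U\<close>.\<close>

lemma has_continuous_selection_of_order:
  fixes le :: "'a \<Rightarrow> 'a \<Rightarrow> bool"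
  assumes refl: "\<And>x. x \<in> topspace X \<Longrightarrow> le x x"
    and antisym: "\<And>x y. le x y \<Longrightarrow> le y x \<Longrightarrow> x = y"
    and trans: "\<And>x y z. le x y \<Longrightarrow> le y z \<Longrightarrow> le x z"
    and total: "\<And>x y. x \<in> topspace X \<Longrightarrow> y \<in> topspace X \<Longrightarrow> le x y \<or> le y x"
    and below_closed: "\<And>x. x \<in> topspace X \<Longrightarrow> closedin X {y. le y x}"
    and below_compact: "\<And>x. x \<in> topspace X \<Longrightarrow> compactin X {y. le y x}"
    and above_closed: "\<And>x. x \<in> topspace X \<Longrightarrow> closedin X {y. le x y}"
  shows "has_continuous_selection X (fell_topology X) (hyperspace X)"
proof -
  have ex_min: "\<exists>m\<in>S. \<forall>y\<in>S. le m y" if S: "closedin X S" "S \<noteq> {}" for S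
  proof -
    obtain x where x: "x \<in> S"
      using S(2) by blast
    have ST: "S \<subseteq> topspace X"
      using closedin_subset[OF S(1)] .
    let ?\<H> = "(\<lambda>y. S \<inter> {u. le u y}) ` S"
    have "{y. le y x} \<inter> \<Inter>?\<H> \<noteq> {}"
    proof (rule compactin_directed_Inter)
      show "compactin X {y. le y x}"
        using below_compact x ST by blast
      show "closedin X H" if "H \<in> ?\<H>" for H
        using that S(1) ST below_closed by (auto intro!: closedin_Int)
      show "{y. le y x} \<inter> H \<noteq> {}" if "H \<in> ?\<H>" for H
      proof -
        obtain y where y: "y \<in> S" "H = S \<inter> {u. le u y}"
          using \<open>H \<in> ?\<H>\<close> by blast
        consider "le x y" | "le y x"
          using total x y(1) ST by blast
        then show ?thesis
        proof cases
          case 1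
          then have "x \<in> {y. le y x} \<inter> H"
            using y x refl ST by blast
          then show ?thesis by blast
        next
          case 2
          then have "y \<in> {y. le y x} \<inter> H"
            using y refl ST by blast
          then show ?thesis by blast
        qed
      qed
      show "?\<H> \<noteq> {}"
        using x by blast
      show "\<exists>F\<in>?\<H>. F \<subseteq> G \<inter> H" if GH: "G \<in> ?\<H>" "H \<in> ?\<H>" for G H
      proof -
        obtain y z where y: "y \<in> S" "G = S \<inter> {u. le u y}" and z: "z \<in> S" "H = S \<inter> {u. le u z}"
          using GH by blast
        consider "le y z" | "le z y"
          using total y(1) z(1) ST by blast
        then show ?thesis
        proof cases
          case 1
          then have "G \<subseteq> G \<inter> H"
            using trans y z by blast
          then show ?thesis using GH(1) by blast
        next
          case 2
          then have "H \<subseteq> G \<inter> H"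
            using trans y z by blast
          then show ?thesis using GH(2) by blast
        qed
      qed
    qed
    then show ?thesis
      using x by blast
  qed
  define f where "f S = (SOME m. m \<in> S \<and> (\<forall>y\<in>S. le m y))" for S
  have f: "f S \<in> S" "\<And>y. y \<in> S \<Longrightarrow> le (f S) y" if "S \<in> hyperspace X" for S
  proof -
    have "\<exists>m. m \<in> S \<and> (\<forall>y\<in>S. le m y)"
      using ex_min that by (auto simp: hyperspace_def)
    from someI_ex[OF this] show "f S \<in> S" "\<And>y. y \<in> S \<Longrightarrow> le (f S) y"
      by (auto simp: f_def)
  qed
  have sub: "S \<subseteq> topspace X" if "S \<in> hyperspace X" for S
    using that closedin_subset by (auto simp: hyperspace_def)
  have "continuous_map (fell_topology X) X f"
  proof (rule continuous_map_fellI)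
    show "f S \<in> topspace X" if "S \<in> hyperspace X" for S
      using f(1)[OF that] sub[OF that] by blast
    fix S U
    assume S: "S \<in> hyperspace X" and U: "openin X U" "f S \<in> U"
    let ?m = "f S"
    have m: "?m \<in> topspace X" "?m \<in> S"
      using f(1)[OF S] sub[OF S] by auto
    have "\<exists>V. openin X V \<and> ?m \<in> V \<and> (\<forall>v\<in>V. \<forall>y. le y v \<longrightarrow> y \<in> topspace X \<longrightarrow> y \<in> U \<or> le y ?m)"
    proof (cases "{y. le ?m y} - U = {}")
      case True
      then show ?thesis
        using total m(1) U by (intro exI[of _ U]) blast
    next
      case False
      have cl: "closedin X ({y. le ?m y} - U)"
        using above_closed[OF m(1)] U(1) by (rule closedin_diff)
      \<comment> \<open>This \<open>b\<close> is the least point above \<open>m\<close> outside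
        \<open>U\<close>; a point of \<open>U\<close> not above \<open>b\<close> has only points of
        \<open>U\<close> between \<open>m\<close> and itself.\<close>
      obtain b where b: "b \<in> {y. le ?m y} - U" "\<And>y. y \<in> {y. le ?m y} - U \<Longrightarrow> le b y"
        using ex_min[OF cl False] by blast
      have bT: "b \<in> topspace X"
        using closedin_subset[OF cl] b(1) by blast
      let ?V = "U - {y. le b y}"
      have "openin X ?V"
        using U(1) above_closed[OF bT] by (rule openin_diff)
      moreover have "?m \<in> ?V"
        using U(2) b(1) antisym[of b ?m] by auto
      moreover have "y \<in> U \<or> le y ?m" if "v \<in> ?V" "le y v" "y \<in> topspace X" for v y
        using that b(2)[of y] trans[of b y v] total[OF m(1) that(3)] by blast
      ultimately show ?thesis
        by blast
    qed
    then obtain V where V: "openin X V" "?m \<in> V"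
      "\<And>v y. v \<in> V \<Longrightarrow> le y v \<Longrightarrow> y \<in> topspace X \<Longrightarrow> y \<in> U \<or> le y ?m"
      by blast
    \<comment> \<open>\<open>S\<close> meets the segment of \<open>m\<close> only in
      \<open>m\<close>, which lies in \<open>U\<close>.\<close>
    let ?K = "{y. le y ?m} - U"
    have Kcl: "closedin X ?K"
      using below_closed[OF m(1)] U(1) by (rule closedin_diff)
    have "compactin X ?K"
      by (rule closed_compactin[OF below_compact[OF m(1)] _ Kcl]) blast
    moreover have "S \<inter> V \<noteq> {}"
      using V(2) m(2) by blast
    moreover have "S \<inter> ?K = {}"
    proof -
      have "y \<in> U" if "y \<in> S" "le y ?m" for y
        using antisym[OF that(2) f(2)[OF S that(1)]] U(2) by simp
      then show ?thesis by blast
    qed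
    moreover have "f S' \<in> U" if S': "S' \<in> hyperspace X" "S' \<inter> V \<noteq> {}" "S' \<inter> ?K = {}" for S'
    proof -
      obtain v where v: "v \<in> S'" "v \<in> V"
        using S'(2) by blast
      have "f S' \<in> S'" "f S' \<in> topspace X" "le (f S') v"
        using f[OF S'(1)] sub[OF S'(1)] v(1) by auto
      then show ?thesis
        using V(3)[OF v(2)] S'(3) by blast
    qed
    ultimately show "\<exists>V K. openin X V \<and> compactin X K \<and> closedin X K \<and> S \<inter> V \<noteq> {} \<and> S \<inter> K = {} \<and>
        (\<forall>S'\<in>hyperspace X. S' \<inter> V \<noteq> {} \<longrightarrow> S' \<inter> K = {} \<longrightarrow> f S' \<in> U)"
      using V(1) Kcl by (intro exI[of _ V] exI[of _ ?K]) simp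
  qed
  then have "continuous_map (subtopology (fell_topology X) (hyperspace X)) X f"
    by (rule continuous_map_from_subtopology)
  then show ?thesis
    using f(1) unfolding has_continuous_selection_def selection_on_def by blast
qed

section \<open>The tournament of a selection for pairs\<close>

locale fell_pair_selection =
  fixes X :: "'a topology" and f :: "'a set \<Rightarrow> 'a"
  assumes Hausdorff: "Hausdorff_space X"
    and selection: "selection_on (hyperspace2 X) f"
    and continuous: "continuous_map (subtopology (fell_topology X) (hyperspace2 X)) X f"
begin

definition sel :: "'a \<Rightarrow> 'a \<Rightarrow> bool" where
  "sel x y \<longleftrightarrow> x \<in> topspace X \<and> y \<in> topspace X \<and> f {x, y} = x"

lemma pair_in_hyperspace2: "x \<in> topspace X \<Longrightarrow> y \<in> topspace X \<Longrightarrow> {x, y} \<in> hyperspace2 X"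
  using closedin_Hausdorff_finite[OF Hausdorff, of "{x, y}"]
  by (auto simp: hyperspace2_def hyperspace_def card_insert_if)

lemma selection_pair: "x \<in> topspace X \<Longrightarrow> y \<in> topspace X \<Longrightarrow> f {x, y} = x \<or> f {x, y} = y"
  using bspec[OF selection[unfolded selection_on_def] pair_in_hyperspace2] by auto

lemma hyperspace2_subset: "hyperspace2 X \<subseteq> hyperspace X"
  by (auto simp: hyperspace2_def)

lemma sel_total: "x \<in> topspace X \<Longrightarrow> y \<in> topspace X \<Longrightarrow> sel x y \<or> sel y x"
  using selection_pair[of x y] by (simp add: sel_def insert_commute[of y x])

lemma sel_antisym: "sel x y \<Longrightarrow> sel y x \<Longrightarrow> x = y"
  by (simp add: sel_def insert_commute[of y x])

text \<open>For \<open>u\<close> near \<open>x\<close> and \<open>v\<close> near \<open>y\<close>,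
  continuity puts \<open>f {u, v}\<close> near \<open>f {x, y} = y\<close>, away from
  \<open>u\<close>.\<close>

lemma sel_closed_graph:
  assumes x: "x \<in> topspace X" and y: "y \<in> topspace X" and n: "\<not> sel x y"
  shows "\<exists>P Q. openin X P \<and> openin X Q \<and> x \<in> P \<and> y \<in> Q \<and> (\<forall>u\<in>P. \<forall>v\<in>Q. \<not> sel u v)"
proof -
  have fy: "f {x, y} = y" "x \<noteq> y"
    using selection_pair[OF x y] n x y by (auto simp: sel_def)
  obtain P Q where PQ: "openin X P" "openin X Q" "x \<in> P" "y \<in> Q" "disjnt P Q"
    using Hausdorff x y fy(2) unfolding Hausdorff_space_def by blast
  obtain \<V> where V: "finite \<V>" "\<And>V. V \<in> \<V> \<Longrightarrow> openin X V"
      "\<And>V. V \<in> \<V> \<Longrightarrow> {x, y} \<inter> V \<noteq> {}" "{x, y} \<subseteq> \<Union>\<V>"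
    and fV: "\<And>S'. \<lbrakk>S' \<in> hyperspace2 X; \<And>V. V \<in> \<V> \<Longrightarrow> S' \<inter> V \<noteq> {}; S' \<subseteq> \<Union>\<V>\<rbrakk> \<Longrightarrow> f S' \<in> Q"
    using continuous_map_fell_neighbourhood[OF continuous hyperspace2_subset pair_in_hyperspace2[OF x y] PQ(2)]
      fy(1) PQ(4) by metis
  \<comment> \<open>Points of \<open>near x\<close> and \<open>near y\<close> together hit every
    member of \<open>\<V>\<close>, since each member contains \<open>x\<close> or
    \<open>y\<close>.\<close>
  define near where "near z = \<Inter>{V \<in> \<V>. z \<in> V}" for z
  have op: "openin X (near z)" if "z \<in> {x, y}" for z
    unfolding near_def by (rule openin_Inter) (use V that in auto)
  have "\<not> sel u v" if uv: "u \<in> P \<inter> near x" "v \<in> Q \<inter> near y" for u v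
  proof
    assume uv': "sel u v"
    have "f {u, v} \<in> Q"
    proof (rule fV)
      show "{u, v} \<in> hyperspace2 X"
        using uv' by (intro pair_in_hyperspace2) (auto simp: sel_def)
      show "{u, v} \<inter> V \<noteq> {}" if "V \<in> \<V>" for V
        using V(3)[OF that] that uv by (auto simp: near_def)
      show "{u, v} \<subseteq> \<Union>\<V>"
        using V(4) uv by (auto simp: near_def)
    qed
    then show False
      using uv' uv(1) PQ(5) by (auto simp: sel_def disjnt_iff)
  qed
  moreover have "openin X (P \<inter> near x)" "openin X (Q \<inter> near y)"
    using PQ(1,2) op by (simp_all add: openin_Int)
  moreover have "x \<in> P \<inter> near x" "y \<in> Q \<inter> near y"
    using PQ by (auto simp: near_def)
  ultimately show ?thesis
    by blast
qed

text \<open>Cocompactness in the Fell base enters here, by continuity at \<open>{a}\<close>. All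
  members of \<open>\<V>\<close> contain \<open>a\<close>; for \<open>v\<close> in their
  intersection, any \<open>y\<close> with \<open>sel y v\<close> lies in the compact complement of
  \<open>\<Union>\<V>\<close> or satisfies \<open>y = f {y, v} \<in> U\<close>.\<close>

lemma sel_below_near:
  assumes "openin X U" "a \<in> U"
  shows "\<exists>V K. openin X V \<and> a \<in> V \<and> compactin X K \<and> (\<forall>v\<in>V. \<forall>y. sel y v \<longrightarrow> y \<in> K \<union> U)"
proof -
  have a: "a \<in> topspace X"
    using assms openin_subset by blast
  then have "f {a} = a" and a2: "{a} \<in> hyperspace2 X"
    using selection_pair[OF a a] pair_in_hyperspace2[OF a a] by auto
  then obtain \<V> where V: "finite \<V>" "\<And>V. V \<in> \<V> \<Longrightarrow> openin X V" "compactin X (topspace X - \<Union>\<V>)"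
      "\<And>V. V \<in> \<V> \<Longrightarrow> {a} \<inter> V \<noteq> {}" "{a} \<subseteq> \<Union>\<V>"
    and fV: "\<And>S'. \<lbrakk>S' \<in> hyperspace2 X; \<And>V. V \<in> \<V> \<Longrightarrow> S' \<inter> V \<noteq> {}; S' \<subseteq> \<Union>\<V>\<rbrakk> \<Longrightarrow> f S' \<in> U"
    using continuous_map_fell_neighbourhood[OF continuous hyperspace2_subset a2 assms(1)] assms(2) by metis
  have "\<V> \<noteq> {}"
    using V(5) by blast
  then have "openin X (\<Inter>\<V>)"
    using V(1,2) by (intro openin_Inter) auto
  moreover have "a \<in> \<Inter>\<V>"
    using V(4) by blast
  moreover have "y \<in> (topspace X - \<Union>\<V>) \<union> U" if "v \<in> \<Inter>\<V>" "sel y v" for v y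
  proof (cases "y \<in> \<Union>\<V>")
    case True
    have "f {y, v} \<in> U"
    proof (rule fV)
      show "{y, v} \<in> hyperspace2 X"
        using that(2) by (intro pair_in_hyperspace2) (auto simp: sel_def)
      show "{y, v} \<inter> V \<noteq> {}" if "V \<in> \<V>" for V
        using that \<open>v \<in> \<Inter>\<V>\<close> by blast
      show "{y, v} \<subseteq> \<Union>\<V>"
        using True that(1) \<open>\<V> \<noteq> {}\<close> by blast
    qed
    then show ?thesis
      using that(2) by (simp add: sel_def)
  next
    case False
    then show ?thesis
      using that(2) by (simp add: sel_def)
  qed
  ultimately show ?thesis
    using V(3) by blast
qed

lemma ex_topological_search_tree: "\<exists>W anc. topological_search_tree X sel W anc"
proof -
  obtain r where r: "well_order_on (topspace X) r"
    using well_order_on by blast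
  define W where "W = r - Id"
  have lin: "refl_on (topspace X) r" "trans r" "antisym r" "total_on (topspace X) r" "wf W"
      "r \<subseteq> topspace X \<times> topspace X"
    using r by (auto simp: W_def order_on_defs)
  obtain anc where anc: "\<And>q x. anc q x \<longleftrightarrow>
    (q, x) \<in> W \<and> (\<forall>r. anc r q \<longrightarrow> (sel r q \<longleftrightarrow> sel r x) \<and> (sel q r \<longleftrightarrow> sel x r))"
    using ex_search_tree[OF lin(5), of sel] by blast
  have "topological_search_tree X sel W anc"
  proof
    show "wf W"
      by (rule lin(5))
    show "trans W"
      unfolding W_def using lin(2,3) by (rule trans_diff_Id)
    show "x \<in> topspace X \<and> y \<in> topspace X" if "(x, y) \<in> W" for x y
      using that lin(6) by (auto simp: W_def)
    show "(x, y) \<in> W \<or> (y, x) \<in> W" if "x \<in> topspace X" "y \<in> topspace X" "x \<noteq> y" for x y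
      using lin(4) that by (auto simp: W_def total_on_def)
    show "anc q x \<longleftrightarrow>
      (q, x) \<in> W \<and> (\<forall>r. anc r q \<longrightarrow> (sel r q \<longleftrightarrow> sel r x) \<and> (sel q r \<longleftrightarrow> sel x r))" for q x
      by (rule anc)
    show "x \<in> topspace X \<and> y \<in> topspace X" if "sel x y" for x y
      using that by (simp add: sel_def)
  qed (fact sel_total sel_antisym sel_closed_graph)+
  then show ?thesis
    by (intro exI)
qed

section \<open>Compact initial segments of the tournament\<close>

lemma closedin_sel:
  assumes "x \<in> topspace X"
  shows "closedin X {y. sel y x}" "closedin X {y. sel x y}"
proof -
  obtain W anc where "topological_search_tree X sel W anc"
    using ex_topological_search_tree by (elim exE)
  then interpret topological_search_tree X sel W anc .
  show "closedin X {y. sel y x}" "closedin X {y. sel x y}"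
    using assms by (rule closedin_R_below, rule closedin_R_above)
qed

text \<open>Once a member \<open>U\<close> of the cover contains \<open>a\<close>, the rest of the
  segment is a closed subset of a compact set.\<close>

lemma compactin_sel_below:
  assumes a: "a \<in> topspace X"
  shows "compactin X {y. sel y a}"
  unfolding compactin_def
proof (intro conjI allI impI)
  show "{y. sel y a} \<subseteq> topspace X"
    by (auto simp: sel_def)
  fix \<U>
  assume \<U>: "Ball \<U> (openin X) \<and> {y. sel y a} \<subseteq> \<Union>\<U>"
  have "sel a a"
    using sel_total a by blast
  then obtain U where U: "U \<in> \<U>" "a \<in> U"
    using \<U> by blast
  then have "openin X U"
    using \<U> by blast
  then obtain V K where "openin X V"
      and K: "a \<in> V" "compactin X K" "\<forall>v\<in>V. \<forall>y. sel y v \<longrightarrow> y \<in> K \<union> U"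
    using sel_below_near[OF _ U(2)] by blast
  have "closedin X ({y. sel y a} - U)"
    using closedin_sel(1)[OF a] \<open>openin X U\<close> by (rule closedin_diff)
  moreover have "{y. sel y a} - U \<subseteq> K"
    using K(1,3) by blast
  ultimately have "compactin X ({y. sel y a} - U)"
    using closed_compactin[OF K(2)] by blast
  moreover have "{y. sel y a} - U \<subseteq> \<Union>\<U>"
    using \<U> by blast
  ultimately obtain \<F> where "finite \<F>" "\<F> \<subseteq> \<U>" "{y. sel y a} - U \<subseteq> \<Union>\<F>"
    using \<U> unfolding compactin_def by meson
  then show "\<exists>\<F>. finite \<F> \<and> \<F> \<subseteq> \<U> \<and> {y. sel y a} \<subseteq> \<Union>\<F>"
    using U(1) by (intro exI[of _ "insert U \<F>"]) auto
qed

text \<open>If some \<open>b\<close> fails \<open>sel b a\<close>, then \<open>a\<close> has a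
  neighbourhood \<open>U\<close> inside the compact set \<open>{y. sel y b}\<close>, which absorbs
  the uncontrolled part in \<open>sel_below_near\<close>. If there is no such \<open>b\<close>, the
  whole space is compact.\<close>

lemma sel_below_locally_compact:
  assumes a: "a \<in> topspace X"
  shows "\<exists>V K. openin X V \<and> a \<in> V \<and> compactin X K \<and> (\<forall>v\<in>V. \<forall>y. sel y v \<longrightarrow> y \<in> K)"
proof (cases "\<forall>b\<in>topspace X. sel b a")
  case True
  then have "{y. sel y a} = topspace X"
    by (auto simp: sel_def)
  then have "compactin X (topspace X)"
    using compactin_sel_below[OF a] by simp
  then show ?thesis
    using a by (intro exI[of _ "topspace X"]) (auto simp: sel_def)
next
  case False
  then obtain b where b: "b \<in> topspace X" "\<not> sel b a"
    by blast
  define U where "U = topspace X - {y. sel b y}"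
  have "openin X U"
    unfolding U_def using closedin_sel(2)[OF b(1)] by blast
  moreover have "a \<in> U"
    using a b(2) by (simp add: U_def)
  ultimately obtain V K where VK: "openin X V" "a \<in> V" "compactin X K"
      "\<forall>v\<in>V. \<forall>y. sel y v \<longrightarrow> y \<in> K \<union> U"
    using sel_below_near[of U a] by blast
  have "U \<subseteq> {y. sel y b}"
    using sel_total[OF b(1)] by (auto simp: U_def)
  then have "\<forall>v\<in>V. \<forall>y. sel y v \<longrightarrow> y \<in> K \<union> {y. sel y b}"
    using VK(4) by blast
  moreover have "compactin X (K \<union> {y. sel y b})"
    using VK(3) compactin_sel_below[OF b(1)] by (rule compactin_Un)
  ultimately show ?thesis
    using VK(1,2) by blast
qed

text \<open>Finitely many of the local bounds suffice. Since \<open>sel\<close> need not be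
  transitive, this is what bounds two-step predecessors of a point.\<close>

lemma sel_below_compact:
  assumes Q: "compactin X Q"
  shows "\<exists>K. compactin X K \<and> (\<forall>v\<in>Q. \<forall>y. sel y v \<longrightarrow> y \<in> K)"
proof -
  define \<U> where "\<U> = {V. openin X V \<and> (\<exists>K. compactin X K \<and> (\<forall>v\<in>V. \<forall>y. sel y v \<longrightarrow> y \<in> K))}"
  have "Q \<subseteq> \<Union>\<U>"
  proof
    fix a
    assume "a \<in> Q"
    then have "a \<in> topspace X"
      using compactin_subset_topspace[OF Q] by blast
    from sel_below_locally_compact[OF this] show "a \<in> \<Union>\<U>"
      unfolding \<U>_def by blast
  qed
  moreover have "Ball \<U> (openin X)"
    by (auto simp: \<U>_def)
  ultimately obtain \<F> where F: "finite \<F>" "\<F> \<subseteq> \<U>" "Q \<subseteq> \<Union>\<F>"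
    using Q unfolding compactin_def by meson
  have "\<forall>V\<in>\<F>. \<exists>K. compactin X K \<and> (\<forall>v\<in>V. \<forall>y. sel y v \<longrightarrow> y \<in> K)"
    using F(2) by (auto simp: \<U>_def)
  then obtain k where k: "\<And>V. V \<in> \<F> \<Longrightarrow> compactin X (k V)"
      "\<And>V v y. V \<in> \<F> \<Longrightarrow> v \<in> V \<Longrightarrow> sel y v \<Longrightarrow> y \<in> k V"
    by metis
  have "compactin X (\<Union>(k ` \<F>))"
    using F(1) k(1) by (intro compactin_Union) auto
  moreover have "y \<in> \<Union>(k ` \<F>)" if "v \<in> Q" "sel y v" for v y
    using F(3) that k(2) by blast
  ultimately show ?thesis
    by blast
qed

lemma has_continuous_selection_hyperspace:
  "has_continuous_selection X (fell_topology X) (hyperspace X)"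
proof -
  obtain W anc where tree: "topological_search_tree X sel W anc"
    using ex_topological_search_tree by (elim exE)
  interpret tree: topological_search_tree X sel W anc
    by (rule tree)
  interpret conv: topological_search_tree X "\<lambda>x y. sel y x" W anc
    by (rule tree.converse_topological_search_tree)
  \<comment> \<open>Reversing the tournament keeps the ancestors and swaps the sides, so the
    traversal is reversed.\<close>
  have conv_le: "conv.le x y \<longleftrightarrow> tree.le y x" for x y
    unfolding conv.le_def tree.le_def conv.lt_def tree.lt_def conv.anceq_def tree.anceq_def
    by (auto simp: sel_def)
  have below_closed: "closedin X {y. tree.le y x}" if "x \<in> topspace X" for x
    using that
  proof (rule tree.closedin_le_below)
    fix p q
    assume "q \<in> tree.left_anc p"
    then have "p \<in> topspace X"
      using tree.anc_carrier by (auto simp: tree.left_anc_def)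
    then show "\<exists>K. compactin X K \<and> (\<forall>r\<in>tree.left_anc p. (q, r) \<in> W \<longrightarrow> r \<in> K)"
      using compactin_sel_below by (intro exI[of _ "{y. sel y p}"]) (simp add: tree.left_anc_def)
  qed
  have above_closed: "closedin X {y. tree.le x y}" if "x \<in> topspace X" for x
  proof -
    have "closedin X {y. conv.le y x}"
      using that
    proof (rule conv.closedin_le_below)
      fix p q
      assume q: "q \<in> conv.left_anc p"
      then have "q \<in> topspace X"
        using tree.anc_carrier by (auto simp: conv.left_anc_def)
      \<comment> \<open>A pivot \<open>r\<close> beyond \<open>q\<close> lies on the same side of
        \<open>q\<close> as \<open>p\<close>, so the tail after \<open>q\<close> stays in the
        compact segment of \<open>q\<close>.\<close>
      moreover have "sel r q" if "r \<in> conv.left_anc p" "(q, r) \<in> W" for r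
        using conv.left_anc_mono[OF q that] by (simp add: conv.left_anc_def)
      ultimately show "\<exists>K. compactin X K \<and> (\<forall>r\<in>conv.left_anc p. (q, r) \<in> W \<longrightarrow> r \<in> K)"
        using compactin_sel_below by (intro exI[of _ "{y. sel y q}"]) simp
    qed
    then show ?thesis
      by (simp add: conv_le)
  qed
  have below_compact: "compactin X {y. tree.le y x}" if x: "x \<in> topspace X" for x
  proof -
    obtain K where "compactin X K" "\<forall>v\<in>{y. sel y x}. \<forall>y. sel y v \<longrightarrow> y \<in> K"
      using sel_below_compact[OF compactin_sel_below[OF x]] by blast
    then show ?thesis
      using tree.compactin_le_below[OF x _ _ below_closed[OF x]] by blast
  qed
  show ?thesis
    by (rule has_continuous_selection_of_order[where le = tree.le])
      (fact tree.le_refl tree.le_antisym tree.le_trans tree.le_total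
        below_closed below_compact above_closed)+
qed

end

theorem corollary1p3:
  fixes X :: "'a topology"
  assumes "Hausdorff_space X"
  shows "has_continuous_selection X (fell_topology X) (hyperspace X) \<longleftrightarrow>
         has_continuous_selection X (fell_topology X) (hyperspace2 X)"
proof
  assume "has_continuous_selection X (fell_topology X) (hyperspace X)"
  then obtain f where f: "selection_on (hyperspace X) f"
      "continuous_map (subtopology (fell_topology X) (hyperspace X)) X f"
    by (auto simp: has_continuous_selection_def)
  have "hyperspace2 X \<subseteq> hyperspace X"
    by (auto simp: hyperspace2_def)
  then have "selection_on (hyperspace2 X) f"
      "continuous_map (subtopology (fell_topology X) (hyperspace2 X)) X f"
    using f continuous_map_from_subtopology_mono by (auto simp: selection_on_def)
  then show "has_continuous_selection X (fell_topology X) (hyperspace2 X)"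
    by (auto simp: has_continuous_selection_def)
next
  assume "has_continuous_selection X (fell_topology X) (hyperspace2 X)"
  then obtain f where "selection_on (hyperspace2 X) f"
      "continuous_map (subtopology (fell_topology X) (hyperspace2 X)) X f"
    by (auto simp: has_continuous_selection_def)
  then interpret fell_pair_selection X f
    using assms by unfold_locales
  show "has_continuous_selection X (fell_topology X) (hyperspace X)"
    by (rule has_continuous_selection_hyperspace)
qed

end
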